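(* Let $f\colon\mathbb{R}^d\to\mathbb{R}$ be a piecewise affine function such that $S(f)=\{x\in\mathbb{R}^d\mid f(x)\le 0\}$ is nonempty, and let $V\subseteq\mathbb{R}^d$ be a given set. Then for $f$ to have an error bound on $V$ it is sufficient that $$\liminf_{\|x\|\to+\infty,\,x\in V}\frac{f(x)}{\|x\|}>0.$$ Moreover, this condition becomes necessary (i.e. it holds whenever $f$ has an error bound on $V$) when $$0^+S(f)\cap\operatorname{cl}\operatorname{cone}V=\{0\}.$$
   Context: $\mathbb{R}^d$ is equipped with an arbitrary norm $\|\cdot\|$; $\operatorname{dist}(x,Q)=\inf_{y\in Q}\|x-y\|$. A set is polyhedral if it is the intersection of finitely many closed half-spaces. A function $f\colon\mathbb{R}^d\to\mathbb{R}$ is piecewise affine if there are finitely many polyhedral sets $Q_1,\ldots,Q_s$ with nonempty, pairwise disjoint interiors covering $\mathbb{R}^d$ and affine functions $F_1,\ldots,F_s$ such that $f=F_k$ on $Q_k$ for each $k$. Equivalently (a known theorem of Gorokhovik and Zorko), $f(x)=\min_{i\in I}\max_{j\in J(i)}(a_{ij}+\langle v_{ij},x\rangle)$ for some finite index sets $I$, $J(i)$ and some $a_{ij}\in\mathbb{R}$, $v_{ij}\in\mathbb{R}^d$. The function $f$ has an error bound on $V$ if there exists $\tau>0$ such that $\tau\operatorname{dist}(x,S(f))\le\max\{f(x),0\}$ for all $x\in V$. The recession cone $0^+Q$ of a nonempty set $Q\subseteq\mathbb{R}^d$ is the set of all $z\in\mathbb{R}^d$ for which there exists $x\in Q$ such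 that $x+\lambda z\in Q$ for all $\lambda\ge 0$. A cone is a nonempty set $K$ with $tx\in K$ for all $x\in K$, $t\ge 0$; for nonempty $V$, $\operatorname{cone}V$ is the smallest cone (not necessarily convex) containing $V$; $\operatorname{cl}$ denotes closure. The lower limit is $\lim_{R\to+\infty}\inf\{f(x)/\|x\| \mid x\in V,\ \|x\|\ge R\}$, with the usual convention $\inf\emptyset=+\infty$. *)

theory Defs
  imports "HOL-Analysis.Analysis"
begin

definition is_norm :: "('a::real_vector \<Rightarrow> real) \<Rightarrow> bool" where
  "is_norm N \<longleftrightarrow>
     (\<forall>x. 0 \<le> N x) \<and>
     (\<forall>x. N x = 0 \<longleftrightarrow> x = 0) \<and>
     (\<forall>c x. N (c *\<^sub>R x) = \<bar>c\<bar> * N x) \<and>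
     (\<forall>x y. N (x + y) \<le> N x + N y)"

text \<open>The infimum is a real one, hence only meaningful for nonempty \<open>Q\<close>.\<close>

definition dist_set :: "('a::real_vector \<Rightarrow> real) \<Rightarrow> 'a \<Rightarrow> 'a set \<Rightarrow> real" where
  "dist_set N x Q = (INF y\<in>Q. N (x - y))"

definition affine_function :: "('a::real_inner \<Rightarrow> real) \<Rightarrow> bool" where
  "affine_function F \<longleftrightarrow> (\<exists>a v. \<forall>x. F x = a + v \<bullet> x)"

definition piecewise_affine :: "('a::euclidean_space \<Rightarrow> real) \<Rightarrow> bool" where
  "piecewise_affine f \<longleftrightarrow>
     (\<exists>(s::nat) (Q :: nat \<Rightarrow> 'a set) (F :: nat \<Rightarrow> 'a \<Rightarrow> real).
        (\<forall>k<s. polyhedron (Q k) \<and> interior (Q k) \<noteq> {}) \<and>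
        (\<forall>i<s. \<forall>j<s. i \<noteq> j \<longrightarrow> interior (Q i) \<inter> interior (Q j) = {}) \<and>
        (\<Union>k<s. Q k) = UNIV \<and>
        (\<forall>k<s. affine_function (F k) \<and> (\<forall>x\<in>Q k. f x = F k x)))"

definition sol_set :: "('a \<Rightarrow> real) \<Rightarrow> 'a set" where
  "sol_set f = {x. f x \<le> 0}"

definition has_error_bound_on ::
    "('a::real_vector \<Rightarrow> real) \<Rightarrow> ('a \<Rightarrow> real) \<Rightarrow> 'a set \<Rightarrow> bool" where
  "has_error_bound_on N f V \<longleftrightarrow>
     (\<exists>\<tau>>0. \<forall>x\<in>V. \<tau> * dist_set N x (sol_set f) \<le> max (f x) 0)"

definition recession_cone :: "'a::real_vector set \<Rightarrow> 'a set" where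
  "recession_cone Q = {z. \<exists>x\<in>Q. \<forall>t\<ge>0. x + t *\<^sub>R z \<in> Q}"

text \<open>The library predicate \<^const>\<open>cone\<close> also holds of the empty set; here cones are nonempty,
  so that the cone generated by the empty set is \<open>{0}\<close>. For nonempty \<open>V\<close> this is
  \<open>cone hull V\<close>.\<close>

definition cone_of :: "'a::real_vector set \<Rightarrow> 'a set" where
  "cone_of V = (\<lambda>K. K \<noteq> {} \<and> cone K) hull V"

text \<open>The infimum is taken in \<^typ>\<open>ereal\<close>, where \<open>Inf {} = \<infinity>\<close>. It is monotone in \<open>R\<close>, so the
  limit always exists.\<close>

definition lower_limit_at_infinity ::
    "('a::real_vector \<Rightarrow> real) \<Rightarrow> ('a \<Rightarrow> real) \<Rightarrow> 'a set \<Rightarrow> ereal" where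
  "lower_limit_at_infinity N f V =
     Lim at_top (\<lambda>R::real. INF x\<in>{x \<in> V. R \<le> N x}. ereal (f x / N x))"

lemma lower_limit_at_infinity_tendsto:
  "((\<lambda>R::real. INF x\<in>{x \<in> V. R \<le> N x}. ereal (f x / N x))
     \<longlongrightarrow> lower_limit_at_infinity N f V) at_top"
proof -
  let ?g = "\<lambda>R::real. INF x\<in>{x \<in> V. R \<le> N x}. ereal (f x / N x)"
  have mono: "?g R \<le> ?g R'" if "R \<le> R'" for R R'
    by (rule INF_superset_mono) (use that in auto)
  have "(?g \<longlongrightarrow> (SUP R. ?g R)) at_top"
  proof (rule order_tendstoI)
    fix a assume "a < (SUP R. ?g R)"
    then obtain R where "a < ?g R" by (auto simp: less_SUP_iff)
    then show "\<forall>\<^sub>F R in at_top. a < ?g R"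
      unfolding eventually_at_top_linorder using mono less_le_trans by blast
  next
    fix a assume a: "(SUP R. ?g R) < a"
    have "?g R < a" for R
      using SUP_upper[of R UNIV ?g] a by (auto intro: le_less_trans)
    then show "\<forall>\<^sub>F R in at_top. ?g R < a" by simp
  qed
  moreover from this have "Lim at_top ?g = (SUP R. ?g R)"
    by (rule tendsto_Lim[OF trivial_limit_at_top_linorder])
  ultimately show ?thesis
    unfolding lower_limit_at_infinity_def by (simp only:)
qed

end

theory Submission
  imports Defs
begin

text \<open>On a polytope piece, splitting the vertices by the sign of the affine function gives a local
  Hoffman bound, and compactness handles the pieces that miss the solution set; hence a piecewise
  affine function has an error bound on every bounded set. Far away, a positive lower limit
  dominates the distance to any fixed solution. Conversely, if the lower limit is not positive, the
  error bound yields points of \<open>V\<close> escaping to infinity whose distance to the solution set is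
  negligible against their norm. Their normalised limit lies in \<open>closure (cone_of V)\<close>, and it is a
  recession direction of one of the finitely many polyhedra making up the solution set.\<close>

section \<open>Norms on a Euclidean space\<close>

lemma is_norm_nonneg: "is_norm N \<Longrightarrow> 0 \<le> N x"
  and is_norm_eq_0_iff: "is_norm N \<Longrightarrow> N x = 0 \<longleftrightarrow> x = 0"
  and is_norm_scaleR: "is_norm N \<Longrightarrow> N (c *\<^sub>R x) = \<bar>c\<bar> * N x"
  and is_norm_triangle: "is_norm N \<Longrightarrow> N (x + y) \<le> N x + N y"
  by (auto simp: is_norm_def)

lemma is_norm_diff_triangle:
  assumes "is_norm N"
  shows "N (x - y) \<le> N x + N y"
  using is_norm_triangle[OF assms, of x "-y"] is_norm_scaleR[OF assms, of "-1" y] by simp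

text \<open>The triangle inequality and homogeneity make \<open>N\<close> convex, and a real-valued
  convex function on a Euclidean space is continuous.\<close>

lemma continuous_on_is_norm:
  fixes N :: "'a::euclidean_space \<Rightarrow> real"
  assumes "is_norm N"
  shows "continuous_on UNIV N"
proof (rule convex_on_continuous)
  show "convex_on UNIV N"
  proof (rule convex_onI)
    fix t :: real and x y assume t: "0 < t" "t < 1"
    show "N ((1 - t) *\<^sub>R x + t *\<^sub>R y) \<le> (1 - t) * N x + t * N y"
      using is_norm_triangle[OF assms, of "(1 - t) *\<^sub>R x" "t *\<^sub>R y"] t
      by (simp add: is_norm_scaleR[OF assms])
  qed simp
qed simp

text \<open>By continuity \<open>N\<close> attains its extrema on the compact Euclidean unit sphere;
  the minimum is positive, and homogeneity extends both bounds to every vector. These constants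
  carry Euclidean estimates over to \<open>N\<close> and back.\<close>

lemma is_norm_equivalent:
  fixes N :: "'a::euclidean_space \<Rightarrow> real"
  assumes "is_norm N"
  obtains a b where "0 < a" "0 < b" "\<And>x. a * norm x \<le> N x" "\<And>x. N x \<le> b * norm x"
proof -
  have cont: "continuous_on (sphere 0 1) N"
    using continuous_on_is_norm[OF assms] continuous_on_subset by blast
  have "\<exists>l. l \<in> sphere (0::'a) 1"
    by (rule exI[of _ "SOME i. i \<in> Basis"]) (simp add: SOME_Basis)
  then have ne: "sphere (0::'a) 1 \<noteq> {}" by blast
  obtain p where p: "p \<in> sphere 0 1" "\<And>x. x \<in> sphere 0 1 \<Longrightarrow> N p \<le> N x"
    using continuous_attains_inf[OF compact_sphere ne cont] by blast
  obtain q where q: "q \<in> sphere 0 1" "\<And>x. x \<in> sphere 0 1 \<Longrightarrow> N x \<le> N q"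
    using continuous_attains_sup[OF compact_sphere ne cont] by blast
  have pos: "0 < N w" if "w \<in> sphere 0 1" for w
    using is_norm_nonneg[OF assms, of w] is_norm_eq_0_iff[OF assms, of w] that by force
  have "N p * norm x \<le> N x \<and> N x \<le> N q * norm x" for x
  proof (cases "x = 0")
    case True
    then show ?thesis using is_norm_eq_0_iff[OF assms, of x] by simp
  next
    case False
    then have "x /\<^sub>R norm x \<in> sphere 0 1" by simp
    from p(2)[OF this] q(2)[OF this] False show ?thesis
      by (simp add: is_norm_scaleR[OF assms] field_simps)
  qed
  with that[of "N p" "N q"] pos p(1) q(1) show thesis by blast
qed

lemma dist_set_le:
  assumes "is_norm N" "y \<in> Q"
  shows "dist_set N x Q \<le> N (x - y)"
  unfolding dist_set_def
  by (rule cINF_lower[OF bdd_belowI2[of _ 0] assms(2)]) (rule is_norm_nonneg[OF assms(1)])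

lemma dist_set_less_obtain:
  assumes "is_norm N" "Q \<noteq> {}" "dist_set N x Q < e"
  obtains y where "y \<in> Q" "N (x - y) < e"
proof -
  have "bdd_below ((\<lambda>y. N (x - y)) ` Q)"
    by (rule bdd_belowI2[of _ 0]) (rule is_norm_nonneg[OF assms(1)])
  with that assms(2,3) show thesis
    unfolding dist_set_def by (subst (asm) cINF_less_iff) auto
qed

section \<open>Error bounds on bounded sets\<close>

lemma affine_function_obtain:
  assumes "affine_function F"
  obtains a v where "F = (\<lambda>x. a + v \<bullet> x)"
  using assms unfolding affine_function_def by fast

lemma convex_affine_le: "convex {x. a + v \<bullet> x \<le> (c::real)}"
  and convex_affine_ge: "convex {x. c \<le> a + v \<bullet> x}"
proof -
  have "{x. a + v \<bullet> x \<le> c} = {x. v \<bullet> x \<le> c - a}" "{x. c \<le> a + v \<bullet> x} = {x. v \<bullet> x \<ge> c - a}"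
    by auto
  then show "convex {x. a + v \<bullet> x \<le> c}" "convex {x. c \<le> a + v \<bullet> x}"
    by (simp_all only: convex_halfspace_le convex_halfspace_ge)
qed

text \<open>Grouping the vertices by the sign of \<open>F\<close> writes a point \<open>x\<close>
  with \<open>F x > 0\<close> as a mixture of some \<open>p\<close>, where \<open>F\<close> is at
  least a fixed \<open>m > 0\<close>, and some \<open>q\<close>, where \<open>F\<close> is
  nonpositive. Walking from \<open>x\<close> towards \<open>q\<close> until \<open>F\<close>
  vanishes stays in \<open>P\<close> and covers a distance of at most \<open>diameter P / m\<close>
  times \<open>F x\<close>.\<close>

lemma polytope_error_bound:
  fixes P :: "'a::euclidean_space set"
  assumes "polytope P" and F: "affine_function F" and "y0 \<in> P" "F y0 \<le> 0"
  shows "\<exists>C\<ge>0. \<forall>x\<in>P. 0 < F x \<longrightarrow> (\<exists>y\<in>P. F y \<le> 0 \<and> norm (x - y) \<le> C * F x)"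
proof -
  obtain W where W: "finite W" "P = convex hull W"
    using \<open>polytope P\<close> unfolding polytope_def by blast
  obtain a v where Fav: "F = (\<lambda>x. a + v \<bullet> x)" using F by (rule affine_function_obtain)
  define A where "A = {w\<in>W. 0 < F w}"
  define B where "B = {w\<in>W. F w \<le> 0}"
  have WAB: "W = A \<union> B" unfolding A_def B_def by auto
  have fin: "finite A" using W(1) by (simp add: A_def)
  \<comment> \<open>Inserting 1 keeps the minimum defined and positive even when no vertex has a
    positive value.\<close>
  define m where "m = Min (insert 1 (F ` A))"
  have m: "0 < m" "\<And>w. w \<in> A \<Longrightarrow> m \<le> F w"
    using fin by (auto simp: m_def A_def)
  have hullA: "m \<le> F p" if "p \<in> convex hull A" for p
  proof -
    have "convex hull A \<subseteq> {x. m \<le> a + v \<bullet> x}"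
      by (rule hull_minimal) (use m(2) Fav convex_affine_ge in auto)
    with that Fav show ?thesis by auto
  qed
  have hullB: "F q \<le> 0" if "q \<in> convex hull B" for q
  proof -
    have "convex hull B \<subseteq> {x. a + v \<bullet> x \<le> 0}"
      by (rule hull_minimal) (auto simp: B_def Fav convex_affine_le)
    with that Fav show ?thesis by auto
  qed
  \<comment> \<open>Without a vertex in \<open>B\<close>, \<open>F\<close> would be at least
    \<open>m\<close> on all of \<open>P\<close>, in particular at \<open>y0\<close>.\<close>
  have Bne: "B \<noteq> {}"
  proof
    assume "B = {}"
    with hullA[of y0] assms(3,4) W(2) WAB m(1) show False by auto
  qed
  have AP: "convex hull A \<subseteq> P" and BP: "convex hull B \<subseteq> P"
    unfolding W(2) by (auto simp: WAB hull_mono subsetD[OF hull_mono])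
  have bP: "bounded P" using \<open>polytope P\<close> polytope_imp_bounded by blast
  have cP: "convex P" using \<open>polytope P\<close> polytope_imp_convex by blast
  have bound: "\<exists>y\<in>P. F y \<le> 0 \<and> norm (x - y) \<le> (diameter P / m) * F x" if x: "x \<in> P" "0 < F x" for x
  proof -
    have "A \<noteq> {}"
      using hullB[of x] x W(2) WAB by auto
    have "convex hull (A \<union> B) \<subseteq> convex hull (convex hull A \<union> convex hull B)"
      by (intro hull_mono Un_mono hull_subset)
    then have "x \<in> convex hull (convex hull A \<union> convex hull B)" using x(1) W(2) WAB by auto
    then obtain w u p q where pq: "p \<in> convex hull A" "q \<in> convex hull B"
      and wu: "0 \<le> w" "0 \<le> u" "w + u = 1" and xw: "x = w *\<^sub>R p + u *\<^sub>R q"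
      using \<open>A \<noteq> {}\<close> Bne by (subst (asm) convex_hull_union_two) auto
    have "w = 1 - u" using wu(3) by simp
    with xw have xeq: "x = (1 - u) *\<^sub>R p + u *\<^sub>R q" by simp
    have u: "0 \<le> u" "u \<le> 1" using wu by auto
    \<comment> \<open>This \<open>t\<close> is the parameter at which the affine function
      \<open>F\<close> vanishes on the segment from \<open>x\<close> to \<open>q\<close>.\<close>
    define t where "t = F x / (F x - F q)"
    define y where "y = (1 - t) *\<^sub>R x + t *\<^sub>R q"
    have Fq: "F q \<le> 0" and Fp: "m \<le> F p" using hullA hullB pq by auto
    have t: "0 \<le> t" "t \<le> 1" unfolding t_def using x(2) Fq by (auto simp: field_simps)
    have affine: "F ((1 - r) *\<^sub>R w + r *\<^sub>R z) = (1 - r) * F w + r * F z" for r w z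
      by (simp add: Fav inner_add_right algebra_simps)
    have "F y = F x - t * (F x - F q)"
      unfolding y_def affine by (simp add: algebra_simps)
    also have "\<dots> = 0" unfolding t_def using x(2) Fq by simp
    finally have Fy: "F y = 0" .
    have yP: "y \<in> P"
      unfolding y_def using cP x(1) pq(2) BP t by (auto simp: convex_alt)
    \<comment> \<open>Both \<open>x - q\<close> and \<open>F x - F q\<close> carry the factor
      \<open>1 - u\<close>, the weight of \<open>p\<close>. It cancels in their quotient, so the
      constant stays uniform as \<open>x\<close> approaches \<open>q\<close>.\<close>
    have "x - q = (1 - u) *\<^sub>R (p - q)" unfolding xeq by (simp add: algebra_simps)
    then have "norm (x - q) = (1 - u) * norm (p - q)" using u by simp
    also have "\<dots> \<le> (1 - u) * diameter P"
      using u diameter_bounded_bound[OF bP, of p q] pq AP BP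
      by (auto simp: dist_norm intro!: mult_left_mono)
    finally have nq: "norm (x - q) \<le> (1 - u) * diameter P" .
    have "F x - F q = (1 - u) * (F p - F q)"
      unfolding xeq affine by (simp add: algebra_simps)
    moreover have "(1 - u) * m \<le> (1 - u) * (F p - F q)"
      using Fp Fq u by (intro mult_left_mono) auto
    ultimately have um: "(1 - u) * m \<le> F x - F q" by simp
    have "x - y = t *\<^sub>R (x - q)" unfolding y_def by (simp add: algebra_simps)
    then have "norm (x - y) = t * norm (x - q)" using t by simp
    also have "\<dots> \<le> t * ((1 - u) * diameter P)" by (rule mult_left_mono[OF nq t(1)])
    also have "\<dots> = t * ((1 - u) * m) * (diameter P / m)" using m(1) by simp
    also have "\<dots> \<le> t * (F x - F q) * (diameter P / m)"
      using um t m(1) diameter_ge_0[OF bP] by (intro mult_right_mono mult_left_mono) auto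
    also have "t * (F x - F q) = F x" unfolding t_def using x(2) Fq by simp
    finally show ?thesis using yP Fy by (intro bexI[of _ y]) (auto simp: mult.commute)
  qed
  have "0 \<le> diameter P / m" using diameter_ge_0[OF bP] m(1) by simp
  with bound show ?thesis by blast
qed

lemma piecewise_affine_obtain:
  assumes "piecewise_affine f"
  obtains s :: nat and Q F where
    "\<And>k. k < s \<Longrightarrow> polyhedron (Q k)" "\<And>k. k < s \<Longrightarrow> affine_function (F k)"
    "\<And>k x. k < s \<Longrightarrow> x \<in> Q k \<Longrightarrow> f x = F k x" "\<And>x. \<exists>k<s. x \<in> Q k"
proof -
  obtain s :: nat and Q F where *:
    "\<forall>k<s. polyhedron (Q k) \<and> interior (Q k) \<noteq> {}" "(\<Union>k<s. Q k) = UNIV"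
    "\<forall>k<s. affine_function (F k) \<and> (\<forall>x\<in>Q k. f x = F k x)"
    using assms unfolding piecewise_affine_def by auto
  show thesis
  proof (rule that[of s Q F])
    show "\<exists>k<s. x \<in> Q k" for x using *(2) by auto
  qed (use *(1,3) in auto)
qed

text \<open>Intersecting the pieces with a box around \<open>X\<close> leaves finitely many
  polytopes. Where one contains a solution, the polytope bound applies; where it contains none,
  \<open>f\<close> is bounded away from 0 while the distance to a fixed solution stays
  bounded.\<close>

lemma piecewise_affine_error_bound_bounded:
  fixes f :: "'a::euclidean_space \<Rightarrow> real"
  assumes "piecewise_affine f" "sol_set f \<noteq> {}" "bounded X"
  obtains C where "0 \<le> C"
    "\<And>x. x \<in> X \<Longrightarrow> 0 < f x \<Longrightarrow> \<exists>y\<in>sol_set f. norm (x - y) \<le> C * f x"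
proof -
  obtain s :: nat and Q F where Q: "\<And>k. k < s \<Longrightarrow> polyhedron (Q k)"
    and F: "\<And>k. k < s \<Longrightarrow> affine_function (F k)"
    and fF: "\<And>k x. k < s \<Longrightarrow> x \<in> Q k \<Longrightarrow> f x = F k x" and cover: "\<And>x. \<exists>k<s. x \<in> Q k"
    using piecewise_affine_obtain[OF assms(1)] by metis
  obtain y0 where y0: "y0 \<in> sol_set f" using assms(2) by blast
  obtain l where X: "X \<subseteq> cbox (-l) l" using bounded_subset_cbox_symmetric[OF assms(3)] by blast
  have "\<exists>C\<ge>0. \<forall>x\<in>Q k \<inter> cbox (-l) l. 0 < f x \<longrightarrow> (\<exists>y\<in>sol_set f. norm (x - y) \<le> C * f x)"
    if k: "k < s" for k
  proof -
    define P where "P = Q k \<inter> cbox (-l) l"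
    have P: "polytope P"
      unfolding P_def polytope_eq_bounded_polyhedron
      using Q[OF k] polytope_imp_polyhedron[OF polytope_interval] bounded_cbox
      by (auto intro: bounded_subset[OF bounded_cbox])
    show ?thesis
    proof (cases "\<exists>y\<in>P. F k y \<le> 0")
      case True
      then obtain C where "C \<ge> 0"
        and C: "\<forall>x\<in>P. 0 < F k x \<longrightarrow> (\<exists>y\<in>P. F k y \<le> 0 \<and> norm (x - y) \<le> C * F k x)"
        using polytope_error_bound[OF P F[OF k]] by blast
      have "\<exists>y\<in>sol_set f. norm (x - y) \<le> C * f x" if x: "x \<in> P" "0 < f x" for x
      proof -
        have "0 < F k x" using x fF[OF k, of x] by (simp add: P_def)
        then obtain y where y: "y \<in> P" "F k y \<le> 0" "norm (x - y) \<le> C * F k x"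
          using C x(1) by blast
        with x(1) fF[OF k, of x] fF[OF k, of y] show ?thesis
          by (intro bexI[of _ y]) (auto simp: P_def sol_set_def)
      qed
      with \<open>C \<ge> 0\<close> show ?thesis unfolding P_def by blast
    next
      case False
      show ?thesis
      proof (cases "P = {}")
        case True
        then show ?thesis unfolding P_def by (intro exI[of _ 0]) auto
      next
        case ne: False
        obtain a v where Fav: "F k = (\<lambda>x. a + v \<bullet> x)"
          using F[OF k] by (rule affine_function_obtain)
        have "continuous_on P (F k)" unfolding Fav by (intro continuous_intros)
        then obtain p where p: "p \<in> P" "\<forall>x\<in>P. F k p \<le> F k x"
          using continuous_attains_inf[OF polytope_imp_compact[OF P] ne] by blast
        have pos: "0 < F k p" using False p(1) by force
        obtain b where b: "\<forall>x\<in>P. norm x \<le> b"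
          using polytope_imp_bounded[OF P] bounded_iff by blast
        have b0: "0 \<le> b" using b p(1) norm_ge_zero order_trans by blast
        \<comment> \<open>The numerator bounds the distance from points of \<open>P\<close> to
          \<open>y0\<close>, and the denominator is the positive minimum of \<open>F k\<close> on
          \<open>P\<close>.\<close>
        define C where "C = (b + norm y0) / F k p"
        have "C \<ge> 0" unfolding C_def using b0 pos by simp
        have "norm (x - y0) \<le> C * f x" if x: "x \<in> P" for x
        proof -
          have "norm (x - y0) \<le> b + norm y0" using norm_triangle_ineq4[of x y0] b x by force
          also have "\<dots> = C * F k p" unfolding C_def using pos by simp
          also have "\<dots> \<le> C * F k x" using p(2) x \<open>C \<ge> 0\<close> by (intro mult_left_mono) auto
          finally show ?thesis using x fF[OF k, of x] by (simp add: P_def)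
        qed
        with \<open>C \<ge> 0\<close> y0 show ?thesis unfolding P_def by blast
      qed
    qed
  qed
  then obtain C where C0: "\<And>k. k < s \<Longrightarrow> C k \<ge> 0"
    and C: "\<And>k x. k < s \<Longrightarrow> x \<in> Q k \<inter> cbox (-l) l \<Longrightarrow> 0 < f x \<Longrightarrow>
      \<exists>y\<in>sol_set f. norm (x - y) \<le> C k * f x"
    by metis
  show thesis
  \<comment> \<open>The constants are nonnegative, so their sum dominates each of them and serves
    all pieces at once.\<close>
  proof (rule that[of "\<Sum>k<s. C k"])
    show "0 \<le> (\<Sum>k<s. C k)" using C0 by (intro sum_nonneg) auto
    fix x assume x: "x \<in> X" "0 < f x"
    obtain k where k: "k < s" "x \<in> Q k" using cover by blast
    then obtain y where y: "y \<in> sol_set f" "norm (x - y) \<le> C k * f x" using C x X by blast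
    have "C k \<le> (\<Sum>k<s. C k)" using k C0 by (intro member_le_sum) auto
    then have "C k * f x \<le> (\<Sum>k<s. C k) * f x" using x(2) by (intro mult_right_mono) auto
    with y show "\<exists>y\<in>sol_set f. norm (x - y) \<le> (\<Sum>k<s. C k) * f x" by force
  qed
qed

section \<open>Behaviour at infinity\<close>

text \<open>This replaces the extended-real limit by a linear growth condition. Taking
  \<open>R\<close> positive makes the division by \<open>N x\<close> harmless. For
  \<open>N\<close>-bounded \<open>V\<close> both sides hold: the infima are eventually infinite, and
  the growth condition is vacuous for large \<open>R\<close>.\<close>

lemma lower_limit_at_infinity_pos_iff:
  "0 < lower_limit_at_infinity N f V \<longleftrightarrow>
     (\<exists>c>0. \<exists>R>0. \<forall>x\<in>V. R \<le> N x \<longrightarrow> c * N x \<le> f x)" (is "?L \<longleftrightarrow> ?R")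
proof
  assume ?L
  then obtain c where "ereal 0 < ereal c" and c: "ereal c < lower_limit_at_infinity N f V"
    using ereal_dense2[of 0 "lower_limit_at_infinity N f V"] by (auto simp: zero_ereal_def)
  then have "0 < c" by simp
  have "\<forall>\<^sub>F R::real in at_top. ereal c < (INF x\<in>{x \<in> V. R \<le> N x}. ereal (f x / N x))"
    using order_tendstoD(1)[OF lower_limit_at_infinity_tendsto c] .
  then obtain R0 :: real
    where R0: "\<And>R. R \<ge> R0 \<Longrightarrow> ereal c < (INF x\<in>{x \<in> V. R \<le> N x}. ereal (f x / N x))"
    unfolding eventually_at_top_linorder by blast
  \<comment> \<open>The maximum with 1 forces \<open>N x > 0\<close> on the region
    considered.\<close>
  define R where "R = max R0 1"
  have "c * N x \<le> f x" if x: "x \<in> V" "R \<le> N x" for x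
  proof -
    have "ereal c < (INF x\<in>{x \<in> V. R \<le> N x}. ereal (f x / N x))"
      using R0[of R] by (simp add: R_def)
    also have "\<dots> \<le> ereal (f x / N x)" using x by (intro INF_lower) auto
    finally have "c < f x / N x" by simp
    moreover have "0 < N x" using x by (simp add: R_def)
    ultimately show ?thesis by (simp add: field_simps)
  qed
  moreover have "0 < R" by (simp add: R_def)
  ultimately show ?R using \<open>0 < c\<close> by blast
next
  assume ?R
  then obtain c R where c: "0 < c" and R: "0 < R" "\<And>x. x \<in> V \<Longrightarrow> R \<le> N x \<Longrightarrow> c * N x \<le> f x"
    by blast
  have "ereal c \<le> (INF x\<in>{x \<in> V. R' \<le> N x}. ereal (f x / N x))" if "R \<le> R'" for R'
    using that R by (intro INF_greatest) (force simp: field_simps)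
  then have "\<forall>\<^sub>F R'::real in at_top. ereal c \<le> (INF x\<in>{x \<in> V. R' \<le> N x}. ereal (f x / N x))"
    unfolding eventually_at_top_linorder by blast
  then have "ereal c \<le> lower_limit_at_infinity N f V"
    by (rule tendsto_lowerbound[OF lower_limit_at_infinity_tendsto]) simp
  with c show ?L by (metis ereal_less(2) less_le_trans)
qed

section \<open>Cones and recession directions as limits of escaping sequences\<close>

lemma scaleR_in_cone_of:
  assumes "x \<in> V" "0 \<le> c"
  shows "c *\<^sub>R x \<in> cone_of V"
  unfolding cone_of_def hull_def using assms by (auto simp: cone_def)

lemma recession_cone_mono: "A \<subseteq> B \<Longrightarrow> recession_cone A \<subseteq> recession_cone B"
  unfolding recession_cone_def by blast

text \<open>The point \<open>y 0 + t *\<^sub>R z\<close> is the limit of convex combinations of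
  \<open>y 0\<close> and \<open>y n\<close> with weights \<open>1 - t * e n\<close> and
  \<open>t * e n\<close>. These are admissible once \<open>t * e n < 1\<close>, and closedness keeps
  the limit in \<open>S\<close>.\<close>

lemma limit_direction_in_recession_cone:
  fixes S :: "'a::real_normed_vector set"
  assumes "closed S" "convex S" and y: "\<And>n. y n \<in> S"
    and e: "e \<longlonglongrightarrow> 0" "\<And>n. 0 \<le> e n" and z: "(\<lambda>n. e n *\<^sub>R y n) \<longlonglongrightarrow> z"
  shows "z \<in> recession_cone S"
proof -
  have "y 0 + t *\<^sub>R z \<in> S" if t: "0 \<le> t" for t
  proof -
    have lim: "(\<lambda>n. (1 - t * e n) *\<^sub>R y 0 + t *\<^sub>R (e n *\<^sub>R y n)) \<longlonglongrightarrow> (1 - t * 0) *\<^sub>R y 0 + t *\<^sub>R z"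
      by (intro tendsto_intros e z)
    have "(\<lambda>n. t * e n) \<longlonglongrightarrow> t * 0" by (intro tendsto_intros e)
    then have "\<forall>\<^sub>F n in sequentially. t * e n < 1" by (rule order_tendstoD) simp
    then have "\<forall>\<^sub>F n in sequentially. (1 - t * e n) *\<^sub>R y 0 + t *\<^sub>R (e n *\<^sub>R y n) \<in> S"
    proof eventually_elim
      case (elim n)
      have "0 \<le> t * e n" using t e(2) by simp
      with elim y[of 0] y[of n] \<open>convex S\<close> show ?case by (simp add: convex_alt)
    qed
    from Lim_in_closed_set[OF \<open>closed S\<close> this _ lim] show ?thesis by simp
  qed
  with y[of 0] show ?thesis unfolding recession_cone_def by blast
qed

text \<open>Points of \<open>V\<close> scaled to \<open>N\<close>-length 1 have a convergent
  subsequence, whose limit is nonzero and lies in the closed cone. The companions in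
  \<open>S\<close>, scaled by the same factors, have the same limit because the error is negligible
  relative to \<open>N x\<close>; the factors tend to 0, so that limit is a recession
  direction.\<close>

lemma approached_at_infinity_imp_recession_direction:
  fixes N :: "'a::euclidean_space \<Rightarrow> real"
  assumes N: "is_norm N" and "closed S" "convex S"
    and approach: "\<And>n::nat. \<exists>x\<in>V. \<exists>y\<in>S. Suc n \<le> N x \<and> N (x - y) \<le> N x / Suc n"
  obtains z where "z \<in> recession_cone S" "z \<in> closure (cone_of V)" "z \<noteq> 0"
proof -
  obtain x y where x: "\<And>n. x n \<in> V" and y: "\<And>n. y n \<in> S"
    and big: "\<And>n::nat. Suc n \<le> N (x n)" and near: "\<And>n. N (x n - y n) \<le> N (x n) / Suc n"
    using approach by metis
  obtain a b where ab: "0 < a" "0 < b" "\<And>x. a * norm x \<le> N x" "\<And>x. N x \<le> b * norm x"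
    using is_norm_equivalent[OF N] by blast
  have Npos: "0 < N (x n)" for n using big[of n] by simp
  define u where "u = (\<lambda>n. x n /\<^sub>R N (x n))"
  have Nu: "N (u n) = 1" for n
    unfolding u_def using Npos[of n] by (simp add: is_norm_scaleR[OF N])
  have cone: "u n \<in> cone_of V" for n
    unfolding u_def using Npos[of n] x by (intro scaleR_in_cone_of) auto
  have "bounded {v. N v = 1}"
    unfolding bounded_iff
  proof (intro exI ballI)
    fix v assume "v \<in> {v. N v = 1}"
    then show "norm v \<le> 1 / a" using ab(3)[of v] ab(1) by (simp add: field_simps)
  qed
  moreover have "closed {v. N v = 1}"
    using closed_Collect_eq[OF continuous_on_is_norm[OF N] continuous_on_const] by simp
  ultimately have "compact {v. N v = 1}" by (simp add: compact_eq_bounded_closed)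
  then obtain z r where z: "N z = 1" and r: "strict_mono r" and lim: "(u \<circ> r) \<longlonglongrightarrow> z"
    using Nu unfolding compact_def by (metis (mono_tags, lifting) mem_Collect_eq)
  \<comment> \<open>This null sequence majorises both the scaling factors and, up to the constant
    \<open>1 / a\<close>, the gap between the two scaled sequences.\<close>
  have inv0: "(\<lambda>n. 1 / real (Suc (r n))) \<longlonglongrightarrow> 0"
    using LIMSEQ_subseq_LIMSEQ[OF lim_1_over_n[THEN LIMSEQ_Suc] r] by (simp add: o_def)
  have e0: "(\<lambda>n. 1 / N (x (r n))) \<longlonglongrightarrow> 0"
  proof (rule tendsto_sandwich[OF _ _ tendsto_const inv0])
    show "\<forall>\<^sub>F n in sequentially. 0 \<le> 1 / N (x (r n))" using Npos by (simp add: less_imp_le)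
    show "\<forall>\<^sub>F n in sequentially. 1 / N (x (r n)) \<le> 1 / real (Suc (r n))"
      using big by (intro always_eventually allI divide_left_mono) (auto simp: Npos)
  qed
  have diff0: "(\<lambda>n. (1 / N (x (r n))) *\<^sub>R y (r n) - u (r n)) \<longlonglongrightarrow> 0"
  proof (rule tendsto_0_le[OF inv0, of _ "1 / a"], intro always_eventually allI)
    fix n
    let ?d = "(1 / N (x (r n))) *\<^sub>R y (r n) - u (r n)"
    \<comment> \<open>The gap is the error \<open>x - y\<close> divided by \<open>N x\<close>, which
      turns the relative error bound into an absolute one.\<close>
    have "?d = (- (1 / N (x (r n)))) *\<^sub>R (x (r n) - y (r n))"
      unfolding u_def by (simp add: scaleR_right_diff_distrib divide_inverse)
    then have "N ?d = N (x (r n) - y (r n)) / N (x (r n))"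
      using Npos[of "r n"] by (simp only: is_norm_scaleR[OF N]) simp
    also have "\<dots> \<le> 1 / real (Suc (r n))"
      using near[of "r n"] Npos[of "r n"] by (simp add: field_simps)
    finally have "a * norm ?d \<le> 1 / real (Suc (r n))" using ab(3) order_trans by blast
    then have "norm ?d \<le> 1 / real (Suc (r n)) / a"
      by (simp only: pos_le_divide_eq[OF ab(1)] mult.commute)
    then show "norm ?d \<le> norm (1 / real (Suc (r n))) * (1 / a)" by simp
  qed
  have "(\<lambda>n. (1 / N (x (r n))) *\<^sub>R y (r n)) \<longlonglongrightarrow> z"
    using tendsto_add[OF diff0 lim] by (simp add: o_def)
  then have "z \<in> recession_cone S"
    using Npos by (intro limit_direction_in_recession_cone[OF assms(2,3) _ e0]) (auto simp: y less_imp_le)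
  moreover have "z \<in> closure (cone_of V)"
    unfolding closure_sequential using cone lim by (intro exI[of _ "u \<circ> r"]) auto
  moreover have "z \<noteq> 0" using z is_norm_eq_0_iff[OF N, of z] by force
  ultimately show thesis by (rule that)
qed

text \<open>If every \<open>k\<close> failed at some index \<open>m k\<close>, then by
  antimonotonicity all would fail at the sum of these indices, which is at least each of them. This
  yields one polyhedral piece that works for every \<open>n\<close>.\<close>

lemma finite_pigeonhole_antimono:
  fixes P :: "nat \<Rightarrow> nat \<Rightarrow> bool"
  assumes ex: "\<And>n. \<exists>k<s. P k n" and anti: "\<And>k m n. m \<le> n \<Longrightarrow> P k n \<Longrightarrow> P k m"
  obtains k where "k < s" "\<And>n. P k n"
proof -
  have "\<exists>k<s. \<forall>n. P k n"
  proof (rule ccontr)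
    assume "\<not> ?thesis"
    then obtain m where m: "\<And>k. k < s \<Longrightarrow> \<not> P k (m k)" by metis
    obtain k where k: "k < s" "P k (\<Sum>j<s. m j)" using ex by blast
    have "m k \<le> (\<Sum>j<s. m j)" using k(1) by (intro member_le_sum) auto
    with anti k m show False by blast
  qed
  with that show thesis by blast
qed

section \<open>Sufficiency and necessity of the growth condition\<close>

lemma lower_limit_pos_imp_error_bound:
  fixes N :: "'a::euclidean_space \<Rightarrow> real"
  assumes N: "is_norm N" and f: "piecewise_affine f" "sol_set f \<noteq> {}"
    and lim: "0 < lower_limit_at_infinity N f V"
  shows "has_error_bound_on N f V"
proof -
  obtain c R where c: "0 < c" and R: "0 < R"
    and far: "\<And>x. x \<in> V \<Longrightarrow> R \<le> N x \<Longrightarrow> c * N x \<le> f x"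
    using lim unfolding lower_limit_at_infinity_pos_iff by blast
  obtain a b where ab: "0 < a" "0 < b" "\<And>x. a * norm x \<le> N x" "\<And>x. N x \<le> b * norm x"
    using is_norm_equivalent[OF N] by blast
  obtain y0 where y0: "y0 \<in> sol_set f" using f(2) by blast
  have "bounded {x. N x \<le> R}"
    unfolding bounded_iff
  proof (intro exI ballI)
    fix x assume "x \<in> {x. N x \<le> R}"
    then show "norm x \<le> R / a" using ab(3)[of x] ab(1) by (simp add: field_simps)
  qed
  then obtain C where C0: "0 \<le> C" and C: "\<And>x. x \<in> {x. N x \<le> R} \<Longrightarrow> 0 < f x \<Longrightarrow>
      \<exists>y\<in>sol_set f. norm (x - y) \<le> C * f x"
    using piecewise_affine_error_bound_bounded[OF f] by blast
  \<comment> \<open>Chosen so that \<open>N x + N y0 \<le> K * (c * N x)\<close> whenever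
    \<open>R \<le> N x\<close>, using \<open>N y0 \<le> N y0 / R * N x\<close> there.\<close>
  define K where "K = (1 + N y0 / R) / c"
  have K0: "0 < K" unfolding K_def using c R is_norm_nonneg[OF N, of y0]
    by (intro divide_pos_pos add_pos_nonneg) auto
  \<comment> \<open>\<open>K\<close> serves the far region and \<open>b * C\<close> the ball, with
    \<open>b\<close> converting the Euclidean bound to \<open>N\<close>. Since \<open>K\<close> is
    positive, so is \<open>M\<close>, and \<open>1 / M\<close> can be the error bound
    constant.\<close>
  define M where "M = K + b * C"
  have M: "0 < M" "K \<le> M" "b * C \<le> M" unfolding M_def using K0 ab(2) C0 by (auto simp: add_pos_nonneg)
  have main: "dist_set N x (sol_set f) \<le> M * max (f x) 0" if x: "x \<in> V" for x
  proof (cases "f x \<le> 0")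
    case True
    then have "x \<in> sol_set f" by (simp add: sol_set_def)
    from dist_set_le[OF N this, of x] is_norm_eq_0_iff[OF N, of 0] True show ?thesis by simp
  next
    case pos: False
    have "dist_set N x (sol_set f) \<le> M * f x"
    proof (cases "R \<le> N x")
      case True
      have "dist_set N x (sol_set f) \<le> N x + N y0"
        using dist_set_le[OF N y0, of x] is_norm_diff_triangle[OF N, of x y0] by simp
      also have "N y0 = N y0 / R * R" using R by simp
      also have "N x + N y0 / R * R \<le> N x + N y0 / R * N x"
        using True R is_norm_nonneg[OF N, of y0] by (intro add_left_mono mult_left_mono) auto
      also have "\<dots> = K * (c * N x)" unfolding K_def using c by (simp add: field_simps)
      also have "\<dots> \<le> K * f x" using far[OF x True] K0 by (intro mult_left_mono) auto
      also have "\<dots> \<le> M * f x" using M pos by (intro mult_right_mono) auto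
      finally show ?thesis .
    next
      case False
      then obtain y where y: "y \<in> sol_set f" "norm (x - y) \<le> C * f x" using C[of x] pos by auto
      have "dist_set N x (sol_set f) \<le> b * norm (x - y)"
        using dist_set_le[OF N y(1), of x] ab(4)[of "x - y"] by simp
      also have "\<dots> \<le> b * (C * f x)" using y(2) ab(2) by (intro mult_left_mono) auto
      also have "\<dots> = b * C * f x" by simp
      also have "\<dots> \<le> M * f x" using M pos by (intro mult_right_mono) auto
      finally show ?thesis .
    qed
    with pos show ?thesis by simp
  qed
  show ?thesis unfolding has_error_bound_on_def
  proof (intro exI[of _ "1 / M"] conjI ballI)
    show "0 < 1 / M" using M by simp
    fix x assume "x \<in> V"
    from main[OF this] M(1) show "1 / M * dist_set N x (sol_set f) \<le> max (f x) 0"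
      by (simp add: field_simps)
  qed
qed

text \<open>If growth fails, the error bound places far points of \<open>V\<close> relatively close
  to the solution set. Along one polyhedral piece this produces a nonzero recession direction in the
  closed cone, contrary to the trivial intersection.\<close>

lemma error_bound_imp_lower_limit_pos:
  fixes N :: "'a::euclidean_space \<Rightarrow> real"
  assumes N: "is_norm N" and f: "piecewise_affine f" "sol_set f \<noteq> {}"
    and rc: "recession_cone (sol_set f) \<inter> closure (cone_of V) = {0}"
    and eb: "has_error_bound_on N f V"
  shows "0 < lower_limit_at_infinity N f V"
proof (rule ccontr)
  assume "\<not> ?thesis"
  then have small: "\<exists>x\<in>V. R \<le> N x \<and> f x < c * N x" if "0 < c" "0 < R" for c R
    using that unfolding lower_limit_at_infinity_pos_iff by (meson not_le)
  obtain \<tau> where \<tau>: "0 < \<tau>" "\<And>x. x \<in> V \<Longrightarrow> \<tau> * dist_set N x (sol_set f) \<le> max (f x) 0"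
    using eb unfolding has_error_bound_on_def by blast
  obtain s :: nat and Q F where Q: "\<And>k. k < s \<Longrightarrow> polyhedron (Q k)"
    and F: "\<And>k. k < s \<Longrightarrow> affine_function (F k)"
    and fF: "\<And>k x. k < s \<Longrightarrow> x \<in> Q k \<Longrightarrow> f x = F k x" and cover: "\<And>x. \<exists>k<s. x \<in> Q k"
    using piecewise_affine_obtain[OF f(1)] by metis
  \<comment> \<open>The solution set is the union of these pieces and may fail to be convex, whereas
    the limit argument needs a closed convex set; hence the passage to a single piece.\<close>
  define S where "S k = Q k \<inter> {x. F k x \<le> 0}" for k
  have near: "\<exists>k<s. \<exists>x\<in>V. \<exists>y\<in>S k. Suc n \<le> N x \<and> N (x - y) \<le> N x / Suc n" for n :: nat
  proof -
    \<comment> \<open>The slope \<open>\<tau> / Suc n\<close> is chosen so that dividing the error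
      bound by \<open>\<tau>\<close> leaves a relative distance below
      \<open>1 / Suc n\<close>.\<close>
    obtain x where x: "x \<in> V" "Suc n \<le> N x" "f x < \<tau> / Suc n * N x"
      using small[of "\<tau> / Suc n" "Suc n"] \<tau>(1) by auto
    have "0 < N x" using x(2) by simp
    then have "max (f x) 0 < \<tau> * (N x / Suc n)" using x(3) \<tau>(1) by simp
    with \<tau>(2)[OF x(1)] have "\<tau> * dist_set N x (sol_set f) < \<tau> * (N x / Suc n)" by linarith
    then have "dist_set N x (sol_set f) < N x / Suc n" using \<tau>(1) by (simp only: mult_less_cancel_left_pos)
    then obtain y where y: "y \<in> sol_set f" "N (x - y) < N x / Suc n"
      by (rule dist_set_less_obtain[OF N f(2)])
    obtain k where k: "k < s" "y \<in> Q k" using cover by blast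
    then have "y \<in> S k" using y(1) fF[OF k] by (simp add: S_def sol_set_def)
    with k x y show ?thesis by (meson less_imp_le)
  qed
  \<comment> \<open>The same \<open>x\<close> and \<open>y\<close> serve every smaller index, since
    both conditions only weaken.\<close>
  have anti: "\<exists>x\<in>V. \<exists>y\<in>S k. Suc m \<le> N x \<and> N (x - y) \<le> N x / Suc m"
    if mn: "m \<le> n" and far: "\<exists>x\<in>V. \<exists>y\<in>S k. Suc n \<le> N x \<and> N (x - y) \<le> N x / Suc n" for k m n
  proof -
    obtain x y where xy: "x \<in> V" "y \<in> S k" "Suc n \<le> N x" "N (x - y) \<le> N x / Suc n"
      using far by blast
    have "N x / Suc n \<le> N x / Suc m"
      using mn is_norm_nonneg[OF N, of x] by (intro divide_left_mono) auto
    moreover have "real (Suc m) \<le> real (Suc n)" using mn by simp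
    ultimately show ?thesis using xy by (meson order_trans)
  qed
  obtain k where k: "k < s"
    "\<And>n. \<exists>x\<in>V. \<exists>y\<in>S k. Suc n \<le> N x \<and> N (x - y) \<le> N x / Suc n"
    by (rule finite_pigeonhole_antimono[of s
      "\<lambda>k n. \<exists>x\<in>V. \<exists>y\<in>S k. Suc n \<le> N x \<and> N (x - y) \<le> N x / Suc n", OF near anti]) auto
  obtain a v where Fav: "F k = (\<lambda>x. a + v \<bullet> x)" using F[OF k(1)] by (rule affine_function_obtain)
  have "closed (S k)" unfolding S_def Fav
    by (intro closed_Int polyhedron_imp_closed Q k(1) closed_Collect_le continuous_intros)
  moreover have "convex (S k)" unfolding S_def Fav
    by (intro convex_Int polyhedron_imp_convex Q k(1) convex_affine_le)
  ultimately obtain z where z: "z \<in> recession_cone (S k)" "z \<in> closure (cone_of V)" "z \<noteq> 0"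
    using approached_at_infinity_imp_recession_direction[OF N _ _ k(2)] by blast
  have "S k \<subseteq> sol_set f" using fF[OF k(1)] by (auto simp: S_def sol_set_def)
  with z rc show False using recession_cone_mono by blast
qed

theorem theorem6:
  fixes N :: "real ^ 'n \<Rightarrow> real"
    and f :: "real ^ 'n \<Rightarrow> real"
    and V :: "(real ^ 'n) set"
  assumes "is_norm N"
    and "piecewise_affine f"
    and "sol_set f \<noteq> {}"
  shows "(0 < lower_limit_at_infinity N f V \<longrightarrow> has_error_bound_on N f V) \<and>
         (recession_cone (sol_set f) \<inter> closure (cone_of V) = {0} \<longrightarrow>
            has_error_bound_on N f V \<longrightarrow> 0 < lower_limit_at_infinity N f V)"
  using lower_limit_pos_imp_error_bound[OF assms] error_bound_imp_lower_limit_pos[OF assms] by blast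

end
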